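(* Let $n=2$, $Y=\{(x_0,x_1,y)\in\Lambda^2\times\Lambda^*\mid x_0x_1=1+y\}$, let $f:\mathscr Y\to\mathbb R^2$ be the dual analytic fibration of the Gross Lagrangian fibration $\pi:\mathbb C^2\setminus\{z_1z_2=1\}\to\mathbb R^2$, and let $L_0=\pi^{-1}(0)$ be the singular (immersed) Lagrangian fiber over the unique singular point $0=(0,0)$. On the level of sets of closed points, in the coordinates $z_0=T^{\psi_0}x_0$, $z_1=T^{-\psi_0}x_1$ (which satisfy $z_0z_1=1+y$), the dual singular fiber decomposes as $f^{-1}(0)=\mathbf S_1\sqcup\mathbf S_2$, where, via $(z_0,z_1,y)\mapsto(z_0,z_1)$, $$\mathbf S_1\cong(\Lambda_0\times\Lambda_+)\cup(\Lambda_+\times\Lambda_0),\qquad \mathbf S_2\cong\{(z_0,z_1)\in U_\Lambda\times U_\Lambda\mid\bar z_0\bar z_1\ne1\},$$ and the Maurer-Cartan set of $L_0$ is $$\mathcal{MC}(L_0)=\mathbf S_1\subsetneq f^{-1}(0).$$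
   Context: $\Lambda=\mathbb C((T^{\mathbb R}))$ is the Novikov field (series $\sum_{i\ge0}a_iT^{\lambda_i}$, $a_i\in\mathbb C$, $\lambda_i\in\mathbb R$ strictly increasing and divergent) with valuation $\mathsf v$; $\Lambda_0=\{\mathsf v\ge0\}$, $\Lambda_+=\{\mathsf v>0\}$, $U_\Lambda=\{\mathsf v=0\}=\mathbb C^*\oplus\Lambda_+$, and $z\mapsto\bar z$ is the reduction $U_\Lambda\to\mathbb C^*$. **A side.** $\pi(z_1,z_2)=\left(\frac12(|z_1|^2-|z_2|^2),\log|z_1z_2-1|\right)$ on $X=\mathbb C^2\setminus\{z_1z_2=1\}$ with the standard symplectic form $\omega$; its only singular value is $0=(0,0)$. $L_q=\pi^{-1}(q)$ for $q=(q_1,q_2)$, $D_j=\{z_j=0\}$, $E(\beta)=\frac1{2\pi}\int_\beta\omega$. The continuous function $\psi:\mathbb R^2\to(0,\infty)$ is determined by: for $q_2>0$, $\psi(q)=\min\{E(\beta_1),E(\beta_2)\}$ with $\beta_1,\beta_2$ the basis of $\pi_2(\mathbb C^2,L_q)$ with $\beta_i\cdot D_j=\delta_{ij}$; for $q_2<0$, $\psi(q)=E(\hat\beta)$ where $\hat\beta$ is the class of a section of $z_1z_2$ over $\{|\zeta-1|\le e^{q_2}\}$ with boundary on $L_q$. Put $\psi_0(q_1)=\psi(q_1,0)$, and write $\psi_0=\psi_0(0)>0$ when no argument is displayed. **B side.** $j:\mathbb R^2\to\mathbb R^3$, $j(q)=(\min\{-\psi(q),-\psi_0(q_1)\}+\min\{0,q_1\},\min\{\psi(q),\psi_0(q_1)\},q_1)$,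 a topological embedding; $F=(F_0,F_1,\mathsf v(y))$ with $F_0=\min\{\mathsf v(x_0),-\psi_0(\mathsf v(y))+\min\{0,\mathsf v(y)\}\}$, $F_1=\min\{\mathsf v(x_1),\psi_0(\mathsf v(y))\}$; $\mathscr Y=\{|x_1|<1\}\subset Y^{\mathrm{an}}$ where $|x|=e^{-\mathsf v(x)}$; $f=j^{-1}\circ F|_{\mathscr Y}$. **Maurer-Cartan set.** $\mathcal{MC}(L_0)$ is the set of Maurer-Cartan solutions (bounding cochains) of the $A_\infty$ algebra associated with the immersed Lagrangian $L_0$ by Akaho-Joyce theory. By a known result of Hong, Kim and Lau, it is the set of pairs $(\Lambda_0\times\Lambda_+)\cup(\Lambda_+\times\Lambda_0)$; the equality in the claim is understood via this identification. *)

theory Defs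
  imports "HOL-Analysis.Analysis"
begin

section \<open>The Novikov field\<close>

text \<open>A series \<open>\<Sum> a\<^sub>i T^(\<lambda>\<^sub>i)\<close> with \<open>\<lambda>\<^sub>i\<close> strictly increasing and divergent (or a finite sum) is
  encoded by its coefficient function \<open>\<lambda> \<mapsto> a\<close>, whose support has finitely many elements
  below every bound.\<close>

typedef novikov = "{a :: real \<Rightarrow> complex. \<forall>c. finite {l. l \<le> c \<and> a l \<noteq> 0}}"
  morphisms coeff Abs_novikov
  by (rule exI[of _ "\<lambda>_. 0"]) simp

setup_lifting type_definition_novikov

lemma novikov_eqI: "(\<And>l. coeff x l = coeff y l) \<Longrightarrow> x = y"
  by (simp add: coeff_inject[symmetric] fun_eq_iff)

lemma finite_supp: "finite {l. l \<le> c \<and> coeff x l \<noteq> 0}"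
  using coeff[of x] by simp

lemma supp_lower: "\<exists>m. \<forall>l. coeff x l \<noteq> 0 \<longrightarrow> m \<le> l"
proof -
  let ?S = "insert 0 {l. l \<le> 0 \<and> coeff x l \<noteq> 0}"
  have fin: "finite ?S" using finite_supp[of 0 x] by simp
  have "Min ?S \<le> l" if "coeff x l \<noteq> 0" for l
  proof (cases "l \<le> 0")
    case True
    then show ?thesis using that fin by (intro Min_le) auto
  next
    case False
    have "Min ?S \<le> 0" using fin by (intro Min_le) auto
    then show ?thesis using False by linarith
  qed
  then show ?thesis by blast
qed

instantiation novikov :: ab_group_add
begin

lift_definition zero_novikov :: novikov is "\<lambda>_. 0" by simp

lift_definition plus_novikov :: "novikov \<Rightarrow> novikov \<Rightarrow> novikov" is "\<lambda>a b l. a l + b l"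
proof -
  fix a b :: "real \<Rightarrow> complex" and c
  assume "\<And>c. finite {l. l \<le> c \<and> a l \<noteq> 0}" "\<And>c. finite {l. l \<le> c \<and> b l \<noteq> 0}"
  then have "finite ({l. l \<le> c \<and> a l \<noteq> 0} \<union> {l. l \<le> c \<and> b l \<noteq> 0})" by simp
  then show "finite {l. l \<le> c \<and> a l + b l \<noteq> 0}" by (rule rev_finite_subset) auto
qed

lift_definition uminus_novikov :: "novikov \<Rightarrow> novikov" is "\<lambda>a l. - a l" by simp

definition minus_novikov :: "novikov \<Rightarrow> novikov \<Rightarrow> novikov" where "x - y = x + - (y :: novikov)"

instance
  by standard (transfer; simp add: fun_eq_iff minus_novikov_def)+

end

lemma coeff_simps [simp]:
  "coeff 0 l = 0" "coeff (x + y) l = coeff x l + coeff y l" "coeff (- x) l = - coeff x l"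
  "coeff (x - y) l = coeff x l - coeff y l"
  by (simp_all add: zero_novikov.rep_eq plus_novikov.rep_eq uminus_novikov.rep_eq minus_novikov_def
    del: add_uminus_conv_diff)

lemma coeff_sum [simp]: "coeff (sum f A) l = (\<Sum>i\<in>A. coeff (f i) l)"
  by (induction A rule: infinite_finite_induct) auto

lift_definition monomial :: "complex \<Rightarrow> real \<Rightarrow> novikov" is "\<lambda>c k l. if l = k then c else 0"
proof -
  fix c :: complex and k d :: real
  have "finite {k}" by simp
  then show "finite {l. l \<le> d \<and> (if l = k then c else 0) \<noteq> 0}"
    by (rule rev_finite_subset) auto
qed

lemma coeff_monomial: "coeff (monomial c k) l = (if l = k then c else 0)"
  by (simp add: monomial.rep_eq)

lemma convolution_finite:
  "finite {a. coeff x a \<noteq> 0 \<and> coeff y (l - a) \<noteq> 0}"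
proof -
  obtain m where m: "\<And>b. coeff y b \<noteq> 0 \<Longrightarrow> m \<le> b" using supp_lower by blast
  have "{a. coeff x a \<noteq> 0 \<and> coeff y (l - a) \<noteq> 0} \<subseteq> {a. a \<le> l - m \<and> coeff x a \<noteq> 0}"
  proof
    fix a assume "a \<in> {a. coeff x a \<noteq> 0 \<and> coeff y (l - a) \<noteq> 0}"
    then show "a \<in> {a. a \<le> l - m \<and> coeff x a \<noteq> 0}" using m[of "l - a"] by simp
  qed
  then show ?thesis using finite_supp by (rule finite_subset)
qed

lemma convolution_novikov:
  "finite {l. l \<le> c \<and> (\<Sum>a | coeff x a \<noteq> 0 \<and> coeff y (l - a) \<noteq> 0. coeff x a * coeff y (l - a)) \<noteq> 0}"
proof -
  obtain m where m: "\<And>b. coeff x b \<noteq> 0 \<Longrightarrow> m \<le> b" using supp_lower by blast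
  obtain n where n: "\<And>b. coeff y b \<noteq> 0 \<Longrightarrow> n \<le> b" using supp_lower by blast
  let ?S = "(\<lambda>(a, b). a + b) ` ({a. a \<le> c - n \<and> coeff x a \<noteq> 0} \<times> {b. b \<le> c - m \<and> coeff y b \<noteq> 0})"
  have fin: "finite ?S" by (intro finite_imageI finite_cartesian_product finite_supp)
  have mem: "l \<in> ?S" if l: "l \<le> c" and nz:
    "(\<Sum>a | coeff x a \<noteq> 0 \<and> coeff y (l - a) \<noteq> 0. coeff x a * coeff y (l - a)) \<noteq> 0" for l
  proof -
    obtain a where a: "coeff x a \<noteq> 0" "coeff y (l - a) \<noteq> 0"
      using sum.not_neutral_contains_not_neutral[OF nz] by blast
    have "a \<le> c - n" "l - a \<le> c - m" using m[OF a(1)] n[OF a(2)] l by linarith+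
    then show ?thesis using a by (intro image_eqI[of _ _ "(a, l - a)"]) auto
  qed
  show ?thesis by (rule finite_subset[OF _ fin]) (use mem in blast)
qed

instantiation novikov :: "{one, times}"
begin

definition one_novikov :: novikov where "1 = monomial 1 0"

definition times_novikov :: "novikov \<Rightarrow> novikov \<Rightarrow> novikov" where
  "x * y = Abs_novikov (\<lambda>l. \<Sum>a | coeff x a \<noteq> 0 \<and> coeff y (l - a) \<noteq> 0. coeff x a * coeff y (l - a))"

instance ..

end

lemma coeff_times:
  "coeff (x * y) l = (\<Sum>a | coeff x a \<noteq> 0 \<and> coeff y (l - a) \<noteq> 0. coeff x a * coeff y (l - a))"
  unfolding times_novikov_def by (subst Abs_novikov_inverse) (simp_all add: convolution_novikov)

lemma coeff_one: "coeff 1 l = (if l = 0 then 1 else 0)"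
  by (simp add: one_novikov_def coeff_monomial)

lemma coeff_times_sum:
  assumes "finite A" "\<And>a. coeff x a \<noteq> 0 \<Longrightarrow> coeff y (l - a) \<noteq> 0 \<Longrightarrow> a \<in> A"
  shows "coeff (x * y) l = (\<Sum>a\<in>A. coeff x a * coeff y (l - a))"
  unfolding coeff_times using assms by (intro sum.mono_neutral_left) auto

lemma coeff_times_sum2:
  assumes A: "finite A" "\<And>a. coeff x a \<noteq> 0 \<Longrightarrow> coeff y (l - a) \<noteq> 0 \<Longrightarrow> a \<in> A"
    and B: "finite B" "\<And>b. coeff y b \<noteq> 0 \<Longrightarrow> coeff x (l - b) \<noteq> 0 \<Longrightarrow> b \<in> B"
  shows "coeff (x * y) l = (\<Sum>a\<in>A. \<Sum>b\<in>B. if a + b = l then coeff x a * coeff y b else 0)"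
proof -
  have "coeff x a * coeff y (l - a) = (\<Sum>b\<in>B. if a + b = l then coeff x a * coeff y b else 0)" for a
  proof -
    have eq: "a + b = l \<longleftrightarrow> b = l - a" for b by auto
    show ?thesis unfolding eq
      using B(2)[of "l - a"] by (subst sum.delta[OF B(1)]) auto
  qed
  then show ?thesis by (simp add: coeff_times_sum[OF A])
qed

lemma novikov_mult_commute: "x * y = y * (x :: novikov)"
proof (rule novikov_eqI)
  fix l
  let ?A = "{a. coeff x a \<noteq> 0 \<and> coeff y (l - a) \<noteq> 0}"
  let ?B = "{a. coeff y a \<noteq> 0 \<and> coeff x (l - a) \<noteq> 0}"
  have "coeff (x * y) l = (\<Sum>a\<in>?A. \<Sum>b\<in>?B. if a + b = l then coeff x a * coeff y b else 0)"
    by (rule coeff_times_sum2) (auto simp: convolution_finite)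
  also have "\<dots> = (\<Sum>b\<in>?B. \<Sum>a\<in>?A. if b + a = l then coeff y b * coeff x a else 0)"
    by (subst sum.swap) (intro sum.cong refl if_cong, simp_all only: add.commute mult.commute)
  also have "\<dots> = coeff (y * x) l"
    by (rule coeff_times_sum2[symmetric]) (auto simp: convolution_finite)
  finally show "coeff (x * y) l = coeff (y * x) l" .
qed

lemma coeff_times_nonzeroD:
  "coeff (x * y) l \<noteq> 0 \<Longrightarrow> \<exists>a. coeff x a \<noteq> 0 \<and> coeff y (l - a) \<noteq> 0"
  unfolding coeff_times by (erule sum.not_neutral_contains_not_neutral) auto

lemma coeff_times3:
  assumes mx: "\<And>a. coeff x a \<noteq> 0 \<Longrightarrow> mx \<le> a" and my: "\<And>a. coeff y a \<noteq> 0 \<Longrightarrow> my \<le> a"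
    and mz: "\<And>a. coeff z a \<noteq> 0 \<Longrightarrow> mz \<le> a"
    and A: "finite A" "\<And>a. coeff x a \<noteq> 0 \<Longrightarrow> a \<le> l - my - mz \<Longrightarrow> a \<in> A"
    and B: "finite B" "\<And>a. coeff y a \<noteq> 0 \<Longrightarrow> a \<le> l - mx - mz \<Longrightarrow> a \<in> B"
    and C: "finite C" "\<And>a. coeff z a \<noteq> 0 \<Longrightarrow> a \<le> l - mx - my \<Longrightarrow> a \<in> C"
  shows "coeff ((x * y) * z) l =
    (\<Sum>a\<in>A. \<Sum>b\<in>B. \<Sum>c\<in>C. if a + b + c = l then coeff x a * coeff y b * coeff z c else 0)"
proof -
  have xy: "coeff (x * y) d = (\<Sum>a\<in>A. \<Sum>b\<in>B. if a + b = d then coeff x a * coeff y b else 0)"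
    if "d \<le> l - mz" for d
  proof (rule coeff_times_sum2[OF A(1) _ B(1)])
    fix a assume "coeff x a \<noteq> 0" "coeff y (d - a) \<noteq> 0"
    then show "a \<in> A" using my[of "d - a"] that by (intro A(2)) auto
  next
    fix b assume "coeff y b \<noteq> 0" "coeff x (d - b) \<noteq> 0"
    then show "b \<in> B" using mx[of "d - b"] that by (intro B(2)) auto
  qed
  have "coeff ((x * y) * z) l = coeff (z * (x * y)) l"
    by (subst novikov_mult_commute) (rule refl)
  also have "\<dots> = (\<Sum>c\<in>C. coeff z c * coeff (x * y) (l - c))"
  proof (rule coeff_times_sum[OF C(1)])
    fix c assume c: "coeff z c \<noteq> 0" "coeff (x * y) (l - c) \<noteq> 0"
    then obtain a where "coeff x a \<noteq> 0" "coeff y (l - c - a) \<noteq> 0"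
      using coeff_times_nonzeroD by blast
    then show "c \<in> C" using c mx[of a] my[of "l - c - a"] by (intro C(2)) auto
  qed
  also have "\<dots> = (\<Sum>c\<in>C. \<Sum>a\<in>A. \<Sum>b\<in>B.
      if a + b + c = l then coeff x a * coeff y b * coeff z c else 0)"
  proof (rule sum.cong[OF refl])
    fix c
    have eq: "a + b = l - c \<longleftrightarrow> a + b + c = l" for a b by auto
    show "coeff z c * coeff (x * y) (l - c) = (\<Sum>a\<in>A. \<Sum>b\<in>B.
      if a + b + c = l then coeff x a * coeff y b * coeff z c else 0)"
    proof (cases "coeff z c = 0")
      case True
      then show ?thesis by (auto intro!: sum.neutral[symmetric] sum.neutral)
    next
      case False
      then have "l - c \<le> l - mz" using mz[of c] by linarith
      then have "coeff z c * coeff (x * y) (l - c) = coeff z c *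
          (\<Sum>a\<in>A. \<Sum>b\<in>B. if a + b + c = l then coeff x a * coeff y b else 0)"
        by (simp only: xy eq)
      also have "\<dots> = (\<Sum>a\<in>A. \<Sum>b\<in>B.
          coeff z c * (if a + b + c = l then coeff x a * coeff y b else 0))"
        by (simp only: sum_distrib_left)
      also have "\<dots> = (\<Sum>a\<in>A. \<Sum>b\<in>B.
          if a + b + c = l then coeff x a * coeff y b * coeff z c else 0)"
        by (rule sum.cong[OF refl], rule sum.cong[OF refl]) simp
      finally show ?thesis .
    qed
  qed
  also have "\<dots> = (\<Sum>a\<in>A. \<Sum>b\<in>B. \<Sum>c\<in>C.
      if a + b + c = l then coeff x a * coeff y b * coeff z c else 0)"
    by (subst sum.swap, rule sum.cong[OF refl], rule sum.swap)
  finally show ?thesis .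
qed

lemma novikov_mult_assoc: "(x * y) * z = x * (y * (z :: novikov))"
proof (rule novikov_eqI)
  fix l
  obtain mx where mx: "\<And>b. coeff x b \<noteq> 0 \<Longrightarrow> mx \<le> b" using supp_lower by blast
  obtain my where my: "\<And>b. coeff y b \<noteq> 0 \<Longrightarrow> my \<le> b" using supp_lower by blast
  obtain mz where mz: "\<And>b. coeff z b \<noteq> 0 \<Longrightarrow> mz \<le> b" using supp_lower by blast
  define A where "A = {a. a \<le> l - my - mz \<and> coeff x a \<noteq> 0}"
  define B where "B = {a. a \<le> l - mx - mz \<and> coeff y a \<noteq> 0}"
  define C where "C = {a. a \<le> l - mx - my \<and> coeff z a \<noteq> 0}"
  have fin: "finite A" "finite B" "finite C" by (simp_all add: A_def B_def C_def finite_supp)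
  have "coeff ((x * y) * z) l =
    (\<Sum>a\<in>A. \<Sum>b\<in>B. \<Sum>c\<in>C. if a + b + c = l then coeff x a * coeff y b * coeff z c else 0)"
    by (rule coeff_times3[OF mx my mz]) (auto simp: fin, auto simp: A_def B_def C_def)
  also have "\<dots> =
    (\<Sum>b\<in>B. \<Sum>c\<in>C. \<Sum>a\<in>A. if b + c + a = l then coeff y b * coeff z c * coeff x a else 0)"
    by (subst sum.swap, rule sum.cong[OF refl], subst sum.swap)
      (intro sum.cong refl if_cong, simp_all only: ac_simps)
  also have "\<dots> = coeff ((y * z) * x) l"
    by (rule coeff_times3[OF my mz mx, symmetric]) (auto simp: fin, auto simp: A_def B_def C_def)
  finally show "coeff ((x * y) * z) l = coeff (x * (y * z)) l"
    by (subst novikov_mult_commute[of x "y * z"])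
qed

lemma coeff_monomial_times: "coeff (monomial c k * x) l = c * coeff x (l - k)"
  by (subst coeff_times_sum[of "{k}"]) (auto simp: coeff_monomial split: if_splits)

instance novikov :: comm_ring_1
proof
  fix x y z :: novikov
  show "(x * y) * z = x * (y * z)" by (rule novikov_mult_assoc)
  show "x * y = y * x" by (rule novikov_mult_commute)
  show "1 * x = x"
    by (rule novikov_eqI) (simp add: one_novikov_def coeff_monomial_times)
  show "(x + y) * z = x * z + y * z"
  proof (rule novikov_eqI)
    fix l
    let ?S = "\<lambda>x. {a. coeff x a \<noteq> 0 \<and> coeff z (l - a) \<noteq> 0}"
    have fin: "finite (?S x \<union> ?S y)" by (simp add: convolution_finite)
    show "coeff ((x + y) * z) l = coeff (x * z + y * z) l"
      by (simp, subst (1 2 3) coeff_times_sum[OF fin]) (auto simp: sum.distrib distrib_right)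
  qed
  show "(0 :: novikov) \<noteq> 1"
  proof
    assume "(0 :: novikov) = 1"
    then have "coeff 0 0 = coeff 1 0" by simp
    then show False by (simp add: coeff_one)
  qed
qed

lemma power_supp:
  assumes "\<And>l. coeff g l \<noteq> 0 \<Longrightarrow> d \<le> l"
  shows "coeff (g ^ n) l \<noteq> 0 \<Longrightarrow> real n * d \<le> l"
proof (induction n arbitrary: l)
  case 0
  then show ?case by (auto simp: coeff_one split: if_splits)
next
  case (Suc n)
  then obtain a where a: "coeff g a \<noteq> 0" "coeff (g ^ n) (l - a) \<noteq> 0"
    using coeff_times_nonzeroD[of g "g ^ n" l] by auto
  from assms[OF a(1)] Suc.IH[OF a(2)] show ?case by (simp add: algebra_simps)
qed

lemma geometric_inverse:
  assumes d: "d > 0" "\<And>l. coeff g l \<noteq> 0 \<Longrightarrow> d \<le> l"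
  shows "\<exists>h. (1 - g) * h = (1 :: novikov)"
proof -
  define N where "N l = nat \<lceil>l / d\<rceil>" for l
  have N: "l < real (Suc n) * d" if "n \<ge> N l" for n l
  proof -
    have "l / d \<le> real (N l)" unfolding N_def by linarith
    then have "l / d < real (Suc n)" using that by simp
    then show ?thesis using d by (simp add: pos_divide_less_eq)
  qed
  define s where "s n = (\<Sum>i\<le>n. g ^ i)" for n :: nat
  have pow0: "coeff (g ^ i) l = 0" if "i > N l" for i l
  proof (rule ccontr)
    assume "coeff (g ^ i) l \<noteq> 0"
    then have "real i * d \<le> l" using power_supp[of g d i l] d(2) by blast
    moreover have "l < real (Suc (i - 1)) * d" using that by (intro N) auto
    ultimately show False using that by simp
  qed
  have s_eq: "coeff (s n) l = coeff (s (N l)) l" if "n \<ge> N l" for n l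
    unfolding s_def coeff_sum using that pow0 by (intro sum.mono_neutral_right) auto
  have mono: "N l \<le> N c" if "l \<le> c" for l c
    unfolding N_def using that d by (intro nat_mono ceiling_mono divide_right_mono) auto
  have "finite {l. l \<le> c \<and> coeff (s (N l)) l \<noteq> 0}" for c
  proof -
    have "{l. l \<le> c \<and> coeff (s (N l)) l \<noteq> 0} \<subseteq> {l. l \<le> c \<and> coeff (s (N c)) l \<noteq> 0}"
      using s_eq[OF mono] by (intro Collect_mono) metis
    then show ?thesis using finite_supp by (rule finite_subset)
  qed
  then have "coeff (Abs_novikov (\<lambda>l. coeff (s (N l)) l)) = (\<lambda>l. coeff (s (N l)) l)"
    by (intro Abs_novikov_inverse) simp
  then obtain h where h: "coeff h l = coeff (s (N l)) l" for l
    by (metis (no_types))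
  have g_nonneg: "0 \<le> a" if "coeff (1 - g) a \<noteq> 0" for a
  proof (cases "a = 0")
    case False
    then have "coeff g a \<noteq> 0" using that by (simp add: coeff_one)
    then show ?thesis using d(1) d(2)[of a] by linarith
  qed simp
  have "(1 - g) * h = 1"
  proof (rule novikov_eqI)
    fix l
    let ?S = "{a. coeff (1 - g) a \<noteq> 0 \<and> coeff h (l - a) \<noteq> 0} \<union>
              {a. coeff (1 - g) a \<noteq> 0 \<and> coeff (s (N l)) (l - a) \<noteq> 0}"
    have fin: "finite ?S" by (simp only: finite_Un convolution_finite simp_thms)
    have "coeff ((1 - g) * h) l = (\<Sum>a\<in>?S. coeff (1 - g) a * coeff h (l - a))"
      by (rule coeff_times_sum[OF fin]) auto
    also have "\<dots> = (\<Sum>a\<in>?S. coeff (1 - g) a * coeff (s (N l)) (l - a))"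
    proof (rule sum.cong[OF refl])
      fix a assume "a \<in> ?S"
      then have "0 \<le> a" using g_nonneg by blast
      then have "N (l - a) \<le> N l" by (intro mono) simp
      then show "coeff (1 - g) a * coeff h (l - a) = coeff (1 - g) a * coeff (s (N l)) (l - a)"
        using s_eq[of "l - a" "N l"] h by simp
    qed
    also have "\<dots> = coeff ((1 - g) * s (N l)) l"
      by (rule coeff_times_sum[OF fin, symmetric]) auto
    also have "(1 - g) * s (N l) = 1 - g ^ Suc (N l)"
      unfolding s_def by (rule sum_gp_basic)
    also have "coeff (1 - g ^ Suc (N l)) l = coeff 1 l"
      using pow0[of l "Suc (N l)"] by (simp del: power_Suc)
    finally show "coeff ((1 - g) * h) l = coeff 1 l" .
  qed
  then show ?thesis by blast
qed

lemma novikov_inverse_exists: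
  assumes "(x :: novikov) \<noteq> 0"
  shows "\<exists>y. x * y = 1"
proof -
  obtain c where c: "coeff x c \<noteq> 0" using assms novikov_eqI[of x 0] by auto
  define S where "S = {l. l \<le> c \<and> coeff x l \<noteq> 0}"
  have S: "finite S" "S \<noteq> {}" using c by (auto simp: S_def finite_supp)
  define k where "k = Min S"
  have k: "coeff x k \<noteq> 0" "k \<le> c" using Min_in[OF S] by (auto simp: k_def S_def)
  have k_min: "k \<le> l" if "coeff x l \<noteq> 0" for l
    using that k Min_le[OF S(1), of l] by (cases "l \<le> c") (auto simp: k_def S_def)
  define u where "u = monomial (1 / coeff x k) (- k)"
  define g where "g = 1 - u * x"
  have g: "coeff g l = (if l = 0 then 0 else - coeff x (l + k) / coeff x k)" for l
    using k by (simp add: g_def u_def coeff_monomial_times coeff_one)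
  have pos: "l > 0" if "coeff g l \<noteq> 0" for l
    using that k_min[of "l + k"] by (auto simp: g split: if_splits)
  define D where "D = insert 1 {l. l \<le> 1 \<and> coeff g l \<noteq> 0}"
  have D: "finite D" "D \<noteq> {}" by (auto simp: D_def finite_supp)
  have D0: "0 < Min D" using Min_in[OF D] pos by (auto simp: D_def)
  have "Min D \<le> 1" using D by (intro Min_le) (auto simp: D_def)
  then have "Min D \<le> l" if "coeff g l \<noteq> 0" for l
    using that Min_le[OF D(1), of l] by (cases "l \<le> 1") (auto simp: D_def)
  then obtain h where "(1 - g) * h = 1" using geometric_inverse[OF D0, of g] by blast
  then have "x * (u * h) = 1" by (simp add: g_def mult_ac)
  then show ?thesis by blast
qed

instantiation novikov :: field
begin

definition inverse_novikov :: "novikov \<Rightarrow> novikov" where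
  "inverse (x :: novikov) = (if x = 0 then 0 else (THE y. x * y = 1))"

definition divide_novikov :: "novikov \<Rightarrow> novikov \<Rightarrow> novikov" where
  "divide x y = x * (if y = 0 then 0 else (THE z. y * z = (1 :: novikov)))"

instance
proof
  fix x y :: novikov
  show "inverse (0 :: novikov) = 0" by (simp add: inverse_novikov_def)
  show "divide x y = x * inverse y" by (simp only: divide_novikov_def inverse_novikov_def)
  assume x: "x \<noteq> 0"
  have "\<exists>!y. x * y = 1"
  proof (rule ex_ex1I)
    show "\<exists>y. x * y = 1" by (rule novikov_inverse_exists[OF x])
  next
    fix y z assume "x * y = 1" "x * z = 1"
    then have "y = (x * z) * y" "(x * y) * z = z" by simp_all
    then show "y = z" by (simp only: mult_ac)
  qed
  then have "x * (THE y. x * y = 1) = 1" by (rule theI')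
  then show "inverse x * x = 1" using x by (simp add: inverse_novikov_def mult.commute)
qed

end


abbreviation T_power :: "real \<Rightarrow> novikov" where "T_power k \<equiv> monomial 1 k"

text \<open>The infimum of the empty set makes the valuation of \<open>0\<close> equal to \<open>\<infinity>\<close>.\<close>

definition val :: "novikov \<Rightarrow> ereal" where
  "val x = (INF l\<in>{l. coeff x l \<noteq> 0}. ereal l)"

definition rval :: "novikov \<Rightarrow> real" where "rval x = real_of_ereal (val x)"

definition nov_abs :: "novikov \<Rightarrow> real" where
  "nov_abs x = (if x = 0 then 0 else exp (- rval x))"

definition Lambda_0 :: "novikov set" where "Lambda_0 = {x. 0 \<le> val x}"

definition Lambda_plus :: "novikov set" where "Lambda_plus = {x. 0 < val x}"

definition U_Lambda :: "novikov set" where "U_Lambda = {x. val x = 0}"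

definition reduction :: "novikov \<Rightarrow> complex" where "reduction x = coeff x 0"


section \<open>The Gross Lagrangian fibration\<close>

definition gross_space :: "(complex \<times> complex) set" where
  "gross_space = {(z1, z2). z1 * z2 \<noteq> 1}"

definition gross_map :: "complex \<times> complex \<Rightarrow> real \<times> real" where
  "gross_map = (\<lambda>(z1, z2). (((cmod z1)\<^sup>2 - (cmod z2)\<^sup>2) / 2, ln (cmod (z1 * z2 - 1))))"

definition gross_fibre :: "real \<times> real \<Rightarrow> (complex \<times> complex) set" where
  "gross_fibre q = {z \<in> gross_space. gross_map z = q}"

text \<open>\<open>dx\<and>dy (a, b) = Im (cnj a * b)\<close>, so the standard form is \<open>dx\<^sub>1\<and>dy\<^sub>1 + dx\<^sub>2\<and>dy\<^sub>2\<close>.\<close>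

definition std_omega :: "complex \<times> complex \<Rightarrow> complex \<times> complex \<Rightarrow> real" where
  "std_omega a b = Im (cnj (fst a) * fst b) + Im (cnj (snd a) * snd b)"

definition C1_on_closed_disc :: "(complex \<Rightarrow> complex \<times> complex) \<Rightarrow> bool" where
  "C1_on_closed_disc u \<longleftrightarrow> (\<exists>U. open U \<and> cball 0 1 \<subseteq> U \<and> u differentiable_on U \<and>
     (\<forall>v. continuous_on U (\<lambda>w. frechet_derivative u (at w) v)))"

text \<open>Continuously differentiable representatives of classes in \<open>\<pi>\<^sub>2(\<complex>\<^sup>2, L\<^sub>q)\<close>.\<close>

definition lagrangian_disc :: "real \<times> real \<Rightarrow> (complex \<Rightarrow> complex \<times> complex) \<Rightarrow> bool" where
  "lagrangian_disc q u \<longleftrightarrow> C1_on_closed_disc u \<and> u ` sphere 0 1 \<subseteq> gross_fibre q"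

definition energy :: "(complex \<Rightarrow> complex \<times> complex) \<Rightarrow> real" where
  "energy u = 1 / (2 * pi) * integral (cball 0 1)
     (\<lambda>w. std_omega (frechet_derivative u (at w) 1) (frechet_derivative u (at w) \<i>))"

definition jacobian :: "(complex \<Rightarrow> complex) \<Rightarrow> complex \<Rightarrow> real" where
  "jacobian g w = Im (cnj (frechet_derivative g (at w) 1) * frechet_derivative g (at w) \<i>)"

text \<open>The disc \<open>u\<close> is transverse to the divisor \<open>{z = 0}\<close> (with \<open>z\<close> one of the two coordinates),
  misses it along the boundary, and has algebraic intersection number \<open>n\<close> with it: the
  intersection points are the zeros of \<open>z \<circ> u\<close>, counted with the sign of the Jacobian.\<close>

definition meets_divisor ::
    "(complex \<times> complex \<Rightarrow> complex) \<Rightarrow> (complex \<Rightarrow> complex \<times> complex) \<Rightarrow> int \<Rightarrow> bool" where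
  "meets_divisor z u n \<longleftrightarrow>
     (\<forall>w\<in>cball 0 1. z (u w) = 0 \<longrightarrow> w \<in> ball 0 1 \<and> jacobian (z \<circ> u) w \<noteq> 0) \<and>
     (\<Sum>w | w \<in> ball 0 1 \<and> z (u w) = 0. sgn (jacobian (z \<circ> u) w)) = of_int n"

text \<open>For \<open>q\<^sub>2 \<noteq> 0\<close> the fibre is a Lagrangian torus. The energy of a disc then depends only on its
  class, and for \<open>q\<^sub>2 > 0\<close> the two intersection numbers give an isomorphism
  \<open>\<pi>\<^sub>2(\<complex>\<^sup>2, L\<^sub>q) \<cong> \<int>\<^sup>2\<close>. So prescribing \<open>\<psi>\<close> by all representatives of the basis classes
  \<open>\<beta>\<^sub>1, \<beta>\<^sub>2\<close> (and, for \<open>q\<^sub>2 < 0\<close>, by all sections, parametrised by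
  \<open>\<zeta> = 1 + exp q\<^sub>2 * w\<close>) is consistent.
  There is exactly one such \<open>\<psi>\<close>: its values on \<open>q\<^sub>2 = 0\<close> come from continuity.\<close>

definition is_gross_psi :: "(real \<times> real \<Rightarrow> real) \<Rightarrow> bool" where
  "is_gross_psi \<psi> \<longleftrightarrow> continuous_on UNIV \<psi> \<and> (\<forall>q. 0 < \<psi> q) \<and>
     (\<forall>q1 q2 u1 u2. 0 < q2 \<longrightarrow>
        lagrangian_disc (q1, q2) u1 \<longrightarrow> meets_divisor fst u1 1 \<longrightarrow> meets_divisor snd u1 0 \<longrightarrow>
        lagrangian_disc (q1, q2) u2 \<longrightarrow> meets_divisor fst u2 0 \<longrightarrow> meets_divisor snd u2 1 \<longrightarrow>
        \<psi> (q1, q2) = min (energy u1) (energy u2)) \<and>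
     (\<forall>q1 q2 u. q2 < 0 \<longrightarrow> lagrangian_disc (q1, q2) u \<longrightarrow>
        (\<forall>w\<in>cball 0 1. fst (u w) * snd (u w) = 1 + of_real (exp q2) * w) \<longrightarrow>
        \<psi> (q1, q2) = energy u)"

definition psi0 :: "(real \<times> real \<Rightarrow> real) \<Rightarrow> real \<Rightarrow> real" where
  "psi0 \<psi> q1 = \<psi> (q1, 0)"


section \<open>The dual analytic fibration on closed points\<close>

definition mirror_Y :: "(novikov \<times> novikov \<times> novikov) set" where
  "mirror_Y = {(x0, x1, y). y \<noteq> 0 \<and> x0 * x1 = 1 + y}"

definition mirror_domain :: "(novikov \<times> novikov \<times> novikov) set" where
  "mirror_domain = {(x0, x1, y) \<in> mirror_Y. nov_abs x1 < 1}"

definition j_map :: "(real \<times> real \<Rightarrow> real) \<Rightarrow> real \<times> real \<Rightarrow> real \<times> real \<times> real" where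
  "j_map \<psi> = (\<lambda>(q1, q2).
     (min (- \<psi> (q1, q2)) (- psi0 \<psi> q1) + min 0 q1, min (\<psi> (q1, q2)) (psi0 \<psi> q1), q1))"

text \<open>The minima are taken in the extended reals since \<open>x0\<close> or \<open>x1\<close> may vanish; they are finite.\<close>

definition F_map ::
    "(real \<times> real \<Rightarrow> real) \<Rightarrow> novikov \<times> novikov \<times> novikov \<Rightarrow> real \<times> real \<times> real" where
  "F_map \<psi> = (\<lambda>(x0, x1, y).
     (real_of_ereal (min (val x0) (ereal (- psi0 \<psi> (rval y) + min 0 (rval y)))),
      real_of_ereal (min (val x1) (ereal (psi0 \<psi> (rval y)))),
      rval y))"

text \<open>\<open>f = j\<inverse> \<circ> F\<close> restricted to \<open>\<bar>x1\<bar> < 1\<close>, where \<open>j\<inverse>\<close> is the partial map defined on the image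
  of \<open>j\<close>.\<close>

definition dual_fibration ::
    "(real \<times> real \<Rightarrow> real) \<Rightarrow> novikov \<times> novikov \<times> novikov \<Rightarrow> (real \<times> real) option" where
  "dual_fibration \<psi> p =
     (if p \<in> mirror_domain \<and> F_map \<psi> p \<in> range (j_map \<psi>)
      then Some (inv (j_map \<psi>) (F_map \<psi> p)) else None)"

definition dual_fibre ::
    "(real \<times> real \<Rightarrow> real) \<Rightarrow> real \<times> real \<Rightarrow> (novikov \<times> novikov \<times> novikov) set" where
  "dual_fibre \<psi> q = {p. dual_fibration \<psi> p = Some q}"

definition z_coords ::
    "(real \<times> real \<Rightarrow> real) \<Rightarrow> novikov \<times> novikov \<times> novikov \<Rightarrow> novikov \<times> novikov" where
  "z_coords \<psi> = (\<lambda>(x0, x1, y). (T_power (psi0 \<psi> 0) * x0, T_power (- psi0 \<psi> 0) * x1))"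

end

theory Submission
  imports Defs
begin

text \<open>The fibre of \<open>f\<close> over \<open>0\<close> is computed by inverting \<open>j\<close> at the single point \<open>j(0,0)\<close>, so the only
  symplectic input is that \<open>\<psi>(0, t) = \<psi>(0, 0)\<close> forces \<open>t = 0\<close>. For this one evaluates \<open>\<psi>\<close> on explicit
  discs whose energy density is, pointwise on the unit disc, strictly increasing in the parameter;
  so \<open>\<psi>(0, t)\<close> is strictly increasing on either side of \<open>0\<close>, and by continuity \<open>\<psi>(0, 0)\<close> is a strict
  bound on both sides. In the coordinates \<open>z\<^sub>0, z\<^sub>1\<close> the fibre then consists of the pairs in
  \<open>\<Lambda>\<^sub>0 \<times> \<Lambda>\<^sub>0\<close> such that \<open>z\<^sub>0z\<^sub>1 - 1\<close> has valuation \<open>0\<close>, i.e. whose constant terms do not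
  multiply to \<open>1\<close>; the two pieces are distinguished by whether one of these constant terms vanishes.\<close>

subsection \<open>Integrals and energies of discs\<close>

lemma integrable_on_continuous_compact:
  fixes f :: "'a::euclidean_space \<Rightarrow> real"
  assumes "compact S" "continuous_on S f"
  shows "f integrable_on S"
proof -
  have "integrable lborel (\<lambda>x. indicator S x *\<^sub>R f x)"
    using borel_integrable_compact[OF assms] by (simp add: indicator_def if_distrib cong: if_cong)
  then have "set_integrable lborel S f" by (simp add: set_integrable_def)
  then show ?thesis by (rule set_borel_integral_eq_integral)
qed

text \<open>By compactness \<open>g - f\<close> attains a positive minimum on the ball, and the
  integral of the difference is at least this minimum times the volume. This turns pointwise
  comparison of energy densities into comparison of energies.\<close>

lemma integral_cball_strict_mono:
  fixes f g :: "'a::euclidean_space \<Rightarrow> real"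
  assumes "0 < r" and f: "continuous_on (cball a r) f" and g: "continuous_on (cball a r) g"
    and less: "\<And>x. x \<in> cball a r \<Longrightarrow> f x < g x"
  shows "integral (cball a r) f < integral (cball a r) g"
proof -
  have "continuous_on (cball a r) (\<lambda>x. g x - f x)" by (intro continuous_intros f g)
  moreover have "cball a r \<noteq> {}" using \<open>0 < r\<close> by simp
  ultimately obtain z where z: "z \<in> cball a r" "\<And>x. x \<in> cball a r \<Longrightarrow> g z - f z \<le> g x - f x"
    using continuous_attains_inf[of "cball a r" "\<lambda>x. g x - f x"] by auto
  have "0 < measure lborel (cball a r)" using \<open>0 < r\<close> by (rule content_cball_pos)
  also have "measure lborel (cball a r) = integral (cball a r) (\<lambda>x. 1)"
    using lmeasure_integral[OF lmeasurable_cball[of a r]] by (simp add: measure_completion)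
  finally have "0 < (g z - f z) * integral (cball a r) (\<lambda>x. 1)"
    using less[OF z(1)] by simp
  also have "\<dots> = integral (cball a r) (\<lambda>x. (g z - f z) * 1)" by (rule integral_mult_right[symmetric])
  also have "\<dots> \<le> integral (cball a r) (\<lambda>x. g x - f x)"
    using z(2) by (intro integral_le integrable_on_continuous_compact continuous_intros f g) auto
  also have "\<dots> = integral (cball a r) g - integral (cball a r) f"
    by (intro integral_diff integrable_on_continuous_compact f g compact_cball)
  finally show ?thesis by simp
qed

lemma C1_on_closed_discI:
  assumes "open U" "cball 0 1 \<subseteq> U"
    and D: "\<And>w. w \<in> U \<Longrightarrow> (u has_derivative D w) (at w)"
    and cont: "\<And>v. continuous_on U (\<lambda>w. D w v)"
  shows "C1_on_closed_disc u"
  unfolding C1_on_closed_disc_def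
proof (intro exI conjI allI)
  show "u differentiable_on U"
    using D by (meson differentiable_at_imp_differentiable_on differentiable_def)
  have "frechet_derivative u (at w) = D w" if "w \<in> U" for w
    using D[OF that] by (rule frechet_derivative_at[symmetric])
  then show "continuous_on U (\<lambda>w. frechet_derivative u (at w) v)" for v
    using continuous_on_cong[THEN iffD1, OF refl _ cont[of v], of "\<lambda>w. frechet_derivative u (at w) v"]
    by simp
qed fact+

lemma energy_eq:
  assumes "\<And>w. w \<in> cball 0 1 \<Longrightarrow> (u has_derivative D w) (at w)"
    and "\<And>w. w \<in> cball 0 1 \<Longrightarrow> std_omega (D w 1) (D w \<i>) = e w"
  shows "energy u = 1 / (2 * pi) * integral (cball 0 1) e"
proof -
  have "frechet_derivative u (at w) = D w" if "w \<in> cball 0 1" for w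
    using assms(1)[OF that] by (rule frechet_derivative_at[symmetric])
  then show ?thesis unfolding energy_def using assms(2)
    by (intro arg_cong2[where f="(*)"] integral_cong refl) simp
qed

text \<open>Places the closed unit disc inside the ball of radius \<open>1 / r\<close>, on which
  \<open>section_disc r\<close> is holomorphic.\<close>

lemma norm_less_inverse:
  assumes "0 < r" "r < 1" "norm w \<le> 1"
  shows "norm w < 1 / (r :: real)"
proof -
  have "1 < 1 / r" using assms by simp
  then show ?thesis using assms(3) by linarith
qed

subsection \<open>Sections over small discs\<close>

text \<open>Equal coordinates give \<open>q1 = 0\<close>, and their product \<open>1 + r w\<close>
  makes this a section over the disc of radius \<open>r\<close> about 1; \<open>r\<close> plays the
  role of \<open>exp q2\<close>.\<close>

definition section_disc :: "real \<Rightarrow> complex \<Rightarrow> complex \<times> complex" where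
  "section_disc r w = (csqrt (1 + of_real r * w), csqrt (1 + of_real r * w))"

lemma one_plus_notin_nonpos:
  fixes w :: complex
  assumes "0 < r" "norm w < 1 / r"
  shows "1 + of_real r * w \<notin> \<real>\<^sub>\<le>\<^sub>0"
proof -
  have "norm (of_real r * w) < 1" using assms by (simp add: norm_mult less_divide_eq mult.commute)
  then have "\<bar>Re (of_real r * w)\<bar> < 1" using abs_Re_le_cmod order_le_less_trans by blast
  then show ?thesis by (auto simp: complex_nonpos_Reals_iff)
qed

lemma section_disc_derivative:
  assumes "0 < r" "norm w < 1 / r"
  shows "(section_disc r has_derivative
     (\<lambda>v. (of_real r / (2 * csqrt (1 + of_real r * w)) * v,
           of_real r / (2 * csqrt (1 + of_real r * w)) * v))) (at w)"
proof -
  have "((\<lambda>w. csqrt (1 + of_real r * w)) has_field_derivative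
     of_real r / (2 * csqrt (1 + of_real r * w))) (at w)"
    by (rule derivative_eq_intros refl one_plus_notin_nonpos assms | simp)+
  then show ?thesis
    unfolding section_disc_def[abs_def] by (intro has_derivative_Pair has_field_derivative_imp_has_derivative)
qed

lemma lagrangian_section_disc:
  assumes "0 < r" "r < 1"
  shows "lagrangian_disc (0, ln r) (section_disc r)"
  unfolding lagrangian_disc_def
proof
  show "C1_on_closed_disc (section_disc r)"
  proof (rule C1_on_closed_discI)
    show "cball 0 1 \<subseteq> ball (0 :: complex) (1 / r)"
      using assms by (auto simp: norm_less_inverse)
    show "(section_disc r has_derivative
     (\<lambda>v. (of_real r / (2 * csqrt (1 + of_real r * w)) * v,
           of_real r / (2 * csqrt (1 + of_real r * w)) * v))) (at w)" if "w \<in> ball 0 (1 / r)" for w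
      using that assms by (intro section_disc_derivative) auto
    show "continuous_on (ball 0 (1 / r))
       (\<lambda>w. (of_real r / (2 * csqrt (1 + of_real r * w)) * v,
           of_real r / (2 * csqrt (1 + of_real r * w)) * v))" for v
    proof -
      have "continuous_on (ball 0 (1 / r)) (\<lambda>w. csqrt (1 + of_real r * w))"
        using one_plus_notin_nonpos[OF assms(1)]
        by (intro continuous_on_compose2[OF continuous_on_csqrt] continuous_intros) auto
      moreover have "1 + of_real r * w \<noteq> 0" if "w \<in> ball 0 (1 / r)" for w :: complex
        using one_plus_notin_nonpos[OF assms(1), of w] that by force
      ultimately show ?thesis by (intro continuous_intros) auto
    qed
  qed simp
  show "section_disc r ` sphere 0 1 \<subseteq> gross_fibre (0, ln r)"
    using assms
    by (auto simp: section_disc_def gross_fibre_def gross_space_def gross_map_def norm_mult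
        simp flip: power2_eq_square)
qed

lemma energy_section_disc:
  assumes "0 < r" "r < 1"
  shows "energy (section_disc r) =
    1 / (2 * pi) * integral (cball 0 1) (\<lambda>w. r\<^sup>2 / (2 * cmod (1 + of_real r * w)))"
proof (rule energy_eq)
  fix w :: complex assume w: "w \<in> cball 0 1"
  let ?d = "of_real r / (2 * csqrt (1 + of_real r * w))"
  have "norm w < 1 / r" using w assms by (simp add: norm_less_inverse)
  then show "(section_disc r has_derivative (\<lambda>v. (?d * v, ?d * v))) (at w)"
    using assms by (intro section_disc_derivative)
  \<comment> \<open>The disc is holomorphic, so its area density is the sum of the squared moduli of
    its two coordinate derivatives.\<close>
  have "Im (cnj d * (d * \<i>)) = (norm d)\<^sup>2" for d
    by (simp only: cmod_power2) (simp add: power2_eq_square algebra_simps)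
  then have "Im (cnj ?d * (?d * \<i>)) = (norm ?d)\<^sup>2" .
  also have "\<dots> = r\<^sup>2 / (4 * (norm (csqrt (1 + of_real r * w)))\<^sup>2)"
    by (simp add: norm_divide norm_mult power_divide power_mult_distrib)
  also have "(norm (csqrt (1 + of_real r * w)))\<^sup>2 = norm (1 + of_real r * w)"
    by (simp flip: norm_power)
  finally show "std_omega (?d * 1, ?d * 1) (?d * \<i>, ?d * \<i>) = r\<^sup>2 / (2 * norm (1 + of_real r * w))"
    by (simp add: std_omega_def)
qed

lemma section_density_strict_mono:
  assumes "0 < r" "r < r'" "r' < 1" "norm (w :: complex) \<le> 1"
  shows "r\<^sup>2 / (2 * norm (1 + of_real r * w)) < r'\<^sup>2 / (2 * norm (1 + of_real r' * w))"
proof -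
  \<comment> \<open>In terms of \<open>t = 1 / r > 1\<close> the density is \<open>1 / (2 t \<bar>t + w\<bar>)\<close>, and \<open>\<bar>t + w\<bar>\<close> grows with \<open>t\<close>.\<close>
  define t t' where "t = 1 / r" and "t' = 1 / r'"
  have t: "1 < t'" "t' < t" using assms by (simp_all add: t_def t'_def field_simps)
  have eq: "s\<^sup>2 / (2 * norm (1 + of_real s * w)) = 1 / (2 * (1 / s) * norm (of_real (1 / s) + w))"
    if "0 < s" for s
  proof -
    have "1 + of_real s * w = of_real s * (of_real (1 / s) + w)" using that by (simp add: field_simps)
    then have "norm (1 + of_real s * w) = s * norm (of_real (1 / s) + w)"
      using that by (metis norm_mult norm_of_real abs_of_pos)
    then show ?thesis using that by (simp add: power2_eq_square)
  qed
  have x: "-1 \<le> Re w" using abs_Re_le_cmod[of w] assms(4) by linarith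
  have pos: "0 < norm (of_real t' + w)"
  proof -
    have "0 < Re (of_real t' + w)" using t x by simp
    also have "\<dots> \<le> norm (of_real t' + w)" by (rule complex_Re_le_cmod)
    finally show ?thesis .
  qed
  have "norm (of_real t' + w) \<le> norm (of_real t + w)"
  proof -
    have "(t' + Re w)\<^sup>2 \<le> (t + Re w)\<^sup>2" using t x by (intro power_mono) auto
    then show ?thesis by (simp add: cmod_def)
  qed
  then have "t' * norm (of_real t' + w) < t * norm (of_real t + w)"
    using t pos by (intro mult_less_le_imp_less) auto
  then have "1 / (2 * t * norm (of_real t + w)) < 1 / (2 * t' * norm (of_real t' + w))"
    using t pos order_less_le_trans[OF pos \<open>_ \<le> norm (of_real t + w)\<close>]
    by (intro divide_strict_left_mono mult_pos_pos) auto
  then show ?thesis using eq[of r] eq[of r'] assms unfolding t_def t'_def by simp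
qed

lemma energy_section_disc_strict_mono:
  assumes "0 < r" "r < r'" "r' < 1"
  shows "energy (section_disc r) < energy (section_disc r')"
proof -
  have cont: "continuous_on (cball 0 1) (\<lambda>w. s\<^sup>2 / (2 * norm (1 + complex_of_real s * w)))"
    if "0 < s" "s < 1" for s
  proof (intro continuous_intros ballI)
    fix w :: complex assume "w \<in> cball 0 1"
    then have "norm w < 1 / s" using that by (simp add: norm_less_inverse)
    then have "1 + of_real s * w \<noteq> 0" using one_plus_notin_nonpos[OF that(1)] by force
    then show "2 * norm (1 + of_real s * w) \<noteq> 0" by simp
  qed
  have "integral (cball 0 1) (\<lambda>w. r\<^sup>2 / (2 * norm (1 + complex_of_real r * w)))
      < integral (cball 0 1) (\<lambda>w. r'\<^sup>2 / (2 * norm (1 + complex_of_real r' * w)))"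
    using assms by (intro integral_cball_strict_mono cont section_density_strict_mono) auto
  then show ?thesis using assms by (simp add: energy_section_disc divide_strict_right_mono)
qed

subsection \<open>Discs in the basis classes\<close>

text \<open>A point of \<open>L\<^sub>q\<close>, \<open>q = (0, ln r)\<close>, is \<open>(\<surd>\<rho> e\<^sup>i\<^sup>\<alpha>, \<surd>\<rho> e\<^sup>i\<^sup>\<beta>)\<close> with \<open>\<bar>\<rho> e\<^sup>i\<^sup>\<theta> - 1\<bar> = r\<close>, \<open>\<theta> = \<alpha> + \<beta>\<close>. For
  \<open>r > 1\<close> this gives \<open>\<rho> = x + \<surd>(x\<^sup>2 + c)\<close> with \<open>x = cos \<theta>\<close> and \<open>c = r\<^sup>2 - 1\<close>. The disc below has \<open>\<beta> = 0\<close> on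
  the boundary; its second coordinate is real, so it carries no energy.\<close>

definition graph_root :: "real \<Rightarrow> real \<Rightarrow> real" where
  "graph_root c x = sqrt (x + sqrt (x\<^sup>2 + c))"

definition basis_disc :: "real \<Rightarrow> complex \<Rightarrow> complex \<times> complex" where
  "basis_disc c w = (w * of_real (graph_root c (Re w)), of_real (graph_root c (Re w)))"

definition graph_slope :: "real \<Rightarrow> real \<Rightarrow> real" where
  "graph_slope c x = (1 + x / sqrt (x\<^sup>2 + c)) / (2 * graph_root c x)"

lemma graph_pos:
  assumes "0 < c"
  shows "0 < x + sqrt (x\<^sup>2 + c)" "0 < sqrt (x\<^sup>2 + c)" "0 < graph_root c x"
proof -
  have "sqrt (x\<^sup>2) < sqrt (x\<^sup>2 + c)" using assms by (intro real_sqrt_less_mono) simp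
  then have "\<bar>x\<bar> < sqrt (x\<^sup>2 + c)" by simp
  then show *: "0 < x + sqrt (x\<^sup>2 + c)" "0 < sqrt (x\<^sup>2 + c)" by linarith+
  show "0 < graph_root c x" using * by (simp add: graph_root_def)
qed

lemma graph_root_square:
  assumes "0 < c"
  shows "(graph_root c x)\<^sup>2 = x + sqrt (x\<^sup>2 + c)"
  using graph_pos(1)[OF assms, of x] by (simp add: graph_root_def)

lemma graph_root_derivative:
  assumes "0 < c"
  shows "(graph_root c has_field_derivative graph_slope c x) (at x)"
proof -
  have "0 < x\<^sup>2 + c" using assms by (simp add: add_nonneg_pos)
  then show ?thesis using graph_pos[OF assms, of x] unfolding graph_root_def[abs_def] graph_slope_def
    by (auto intro!: derivative_eq_intros simp: field_simps)
qed

lemma continuous_on_graph: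
  assumes "0 < c"
  shows "continuous_on A (\<lambda>w. graph_root c (Re w))" "continuous_on A (\<lambda>w. graph_slope c (Re w))"
  using graph_pos[OF assms] unfolding graph_slope_def graph_root_def
  by (auto intro!: continuous_intros simp: less_imp_neq[symmetric])

lemma basis_disc_boundary:
  assumes "1 < r" "norm w = 1"
  shows "basis_disc (r\<^sup>2 - 1) w \<in> gross_fibre (0, ln r)"
proof -
  define c where "c = r\<^sup>2 - 1"
  have c: "0 < c" using assms by (simp add: c_def)
  define h where "h = Re w + sqrt ((Re w)\<^sup>2 + c)"
  have g: "graph_root c (Re w) * graph_root c (Re w) = h"
    using graph_root_square[OF c, of "Re w"] by (simp add: h_def power2_eq_square)
  have w: "(Re w)\<^sup>2 + (Im w)\<^sup>2 = 1" using assms(2) by (simp add: cmod_def)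
  \<comment> \<open>\<open>h\<close> is the positive root of \<open>h^2 - 2 h Re w = c\<close>; on
    the unit circle this equation says \<open>norm (w h - 1) = r\<close>.\<close>
  have "(h - Re w)\<^sup>2 = (Re w)\<^sup>2 + c" using c by (simp add: h_def)
  then have h: "h\<^sup>2 - 2 * h * Re w = c" by (simp add: power2_diff algebra_simps)
  have prod: "fst (basis_disc c w) * snd (basis_disc c w) = w * of_real h"
    by (simp add: basis_disc_def g[symmetric])
  have "(norm (w * of_real h - 1))\<^sup>2 = (h * Re w - 1)\<^sup>2 + (h * Im w)\<^sup>2"
    by (simp add: cmod_power2 mult.commute)
  also have "\<dots> = h\<^sup>2 * ((Re w)\<^sup>2 + (Im w)\<^sup>2) - 2 * h * Re w + 1"
    by (simp add: power2_eq_square algebra_simps)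
  also have "\<dots> = r\<^sup>2" using h by (simp add: w c_def)
  finally have "norm (w * of_real h - 1) = r" using assms by (simp add: power2_eq_iff_nonneg)
  moreover from this have "w * of_real h \<noteq> 1" using assms by auto
  moreover have "norm (fst (basis_disc c w)) = norm (snd (basis_disc c w))"
    using assms by (simp add: basis_disc_def norm_mult)
  ultimately show ?thesis
    using prod unfolding gross_fibre_def gross_space_def gross_map_def c_def[symmetric]
    by (simp add: case_prod_beta)
qed

definition basis_disc_deriv :: "real \<Rightarrow> complex \<Rightarrow> complex \<Rightarrow> complex \<times> complex" where
  "basis_disc_deriv c w v =
    (v * of_real (graph_root c (Re w)) + w * of_real (graph_slope c (Re w) * Re v),
     of_real (graph_slope c (Re w) * Re v))"

lemma basis_disc_has_derivative:
  assumes "0 < c"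
  shows "(basis_disc c has_derivative basis_disc_deriv c w) (at w)"
proof -
  have "((\<lambda>w. graph_root c (Re w)) has_derivative (\<lambda>v. graph_slope c (Re w) * Re v)) (at w)"
    using has_derivative_compose[OF has_derivative_Re[OF has_derivative_ident]
        graph_root_derivative[OF assms, unfolded has_field_derivative_def]] .
  note [derivative_intros] = has_derivative_of_real[OF this]
  show ?thesis unfolding basis_disc_def[abs_def] basis_disc_deriv_def[abs_def]
    by (auto intro!: derivative_eq_intros simp: algebra_simps)
qed

lemma basis_disc_swap_has_derivative:
  assumes "0 < c"
  shows "(prod.swap \<circ> basis_disc c has_derivative prod.swap \<circ> basis_disc_deriv c w) (at w)"
  using has_derivative_Pair[OF has_derivative_snd has_derivative_fst,
      OF basis_disc_has_derivative basis_disc_has_derivative, OF assms assms, of w]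
  by (simp add: o_def prod.swap_def)

lemma continuous_on_basis_disc_deriv:
  assumes "0 < c"
  shows "continuous_on A (\<lambda>w. basis_disc_deriv c w v)"
  unfolding basis_disc_deriv_def by (intro continuous_intros continuous_on_graph assms)

lemma lagrangian_basis_disc:
  assumes "1 < r"
  shows "lagrangian_disc (0, ln r) (basis_disc (r\<^sup>2 - 1))"
    "lagrangian_disc (0, ln r) (prod.swap \<circ> basis_disc (r\<^sup>2 - 1))"
proof -
  have c: "0 < r\<^sup>2 - 1" using assms by simp
  show "lagrangian_disc (0, ln r) (basis_disc (r\<^sup>2 - 1))"
    unfolding lagrangian_disc_def
    using assms C1_on_closed_discI[of UNIV, OF _ _ basis_disc_has_derivative[OF c]]
    by (auto intro!: basis_disc_boundary continuous_on_basis_disc_deriv c)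
  \<comment> \<open>Exchanging the coordinates negates \<open>q1\<close> and fixes
    \<open>q2\<close>, so it preserves fibres with \<open>q1 = 0\<close>.\<close>
  have swap: "prod.swap z \<in> gross_fibre (0, ln r)" if "z \<in> gross_fibre (0, ln r)" for z
    using that by (auto simp: gross_fibre_def gross_space_def gross_map_def mult.commute)
  have "continuous_on UNIV (\<lambda>w. (prod.swap \<circ> basis_disc_deriv (r\<^sup>2 - 1) w) v)" for v
    unfolding o_def prod.swap_def
    by (intro continuous_on_Pair continuous_on_fst continuous_on_snd continuous_on_basis_disc_deriv c)
  then have "C1_on_closed_disc (prod.swap \<circ> basis_disc (r\<^sup>2 - 1))"
    by (intro C1_on_closed_discI[of UNIV, OF _ _ basis_disc_swap_has_derivative[OF c]]) auto
  moreover have "(prod.swap \<circ> basis_disc (r\<^sup>2 - 1)) w \<in> gross_fibre (0, ln r)" if "norm w = 1" for w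
    using swap[OF basis_disc_boundary[OF assms that]] by simp
  ultimately show "lagrangian_disc (0, ln r) (prod.swap \<circ> basis_disc (r\<^sup>2 - 1))"
    by (auto simp: lagrangian_disc_def)
qed

text \<open>The first coordinate is \<open>w\<close> times a positive function, so it vanishes only
  at the centre, with positive Jacobian; the second has no zero. Hence the disc represents the class
  \<beta>_1.\<close>

lemma meets_divisor_basis_disc:
  assumes c: "0 < c"
  shows "meets_divisor fst (basis_disc c) 1" "meets_divisor snd (basis_disc c) 0"
proof -
  have pos: "graph_root c x \<noteq> 0" for x using graph_pos(3)[OF c, of x] by simp
  have zero: "fst (basis_disc c w) = 0 \<longleftrightarrow> w = 0" "snd (basis_disc c w) \<noteq> 0" for w
    by (simp_all add: basis_disc_def pos)
  have "(fst \<circ> basis_disc c has_derivative (\<lambda>v. fst (basis_disc_deriv c 0 v))) (at 0)"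
    unfolding o_def by (intro has_derivative_fst basis_disc_has_derivative c)
  then have "frechet_derivative (fst \<circ> basis_disc c) (at 0) = (\<lambda>v. fst (basis_disc_deriv c 0 v))"
    by (rule frechet_derivative_at[symmetric])
  then have jac: "jacobian (fst \<circ> basis_disc c) 0 = (graph_root c 0)\<^sup>2"
    by (simp add: jacobian_def basis_disc_deriv_def power2_eq_square)
  have "{w. w \<in> ball 0 1 \<and> fst (basis_disc c w) = 0} = {0 :: complex}" by (auto simp: zero)
  then show "meets_divisor fst (basis_disc c) 1"
    unfolding meets_divisor_def using pos by (simp add: zero jac sgn_if)
  show "meets_divisor snd (basis_disc c) 0"
    unfolding meets_divisor_def by (simp add: zero)
qed

text \<open>Makes the swapped disc a representative of \<beta>_2.\<close>

lemma meets_divisor_swap: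
  "meets_divisor fst (prod.swap \<circ> u) = meets_divisor snd u"
  "meets_divisor snd (prod.swap \<circ> u) = meets_divisor fst u"
  by (simp_all add: meets_divisor_def[abs_def] o_def)

text \<open>The linear term is set apart because it does not depend on \<open>c\<close>;
  monotonicity in \<open>c\<close> concerns the bracket alone.\<close>

definition basis_density :: "real \<Rightarrow> real \<Rightarrow> real" where
  "basis_density c x = 3 / 2 * x + (sqrt (x\<^sup>2 + c) + x\<^sup>2 / (2 * sqrt (x\<^sup>2 + c)))"

lemma std_omega_basis_disc_deriv:
  assumes c: "0 < c"
  shows "std_omega (basis_disc_deriv c w 1) (basis_disc_deriv c w \<i>) = basis_density c (Re w)"
proof -
  let ?g = "graph_root c (Re w)" and ?S = "sqrt ((Re w)\<^sup>2 + c)"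
  have "std_omega (basis_disc_deriv c w 1) (basis_disc_deriv c w \<i>)
      = ?g\<^sup>2 + ?g * graph_slope c (Re w) * Re w"
    by (simp add: std_omega_def basis_disc_deriv_def power2_eq_square algebra_simps)
  also have "?g * graph_slope c (Re w) = (1 + Re w / ?S) / 2"
    using graph_pos(3)[OF c, of "Re w"] by (simp add: graph_slope_def)
  also have "?g\<^sup>2 = Re w + ?S" by (rule graph_root_square[OF c])
  also have "Re w + ?S + (1 + Re w / ?S) / 2 * Re w = basis_density c (Re w)"
    using graph_pos(2)[OF c, of "Re w"] by (simp add: basis_density_def field_simps power2_eq_square)
  finally show ?thesis .
qed

text \<open>The form is invariant under exchange of the coordinates, so at \<open>q1 = 0\<close> the
  minimum defining \<psi> compares two equal energies.\<close>

lemma energy_basis_disc: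
  assumes c: "0 < c"
  shows "energy (basis_disc c) = 1 / (2 * pi) * integral (cball 0 1) (\<lambda>w. basis_density c (Re w))"
    "energy (prod.swap \<circ> basis_disc c) = energy (basis_disc c)"
proof -
  show *: "energy (basis_disc c) = 1 / (2 * pi) * integral (cball 0 1) (\<lambda>w. basis_density c (Re w))"
    by (rule energy_eq[OF basis_disc_has_derivative std_omega_basis_disc_deriv, OF c c])
  have "std_omega (prod.swap a) (prod.swap b) = std_omega a b" for a b
    by (simp add: std_omega_def)
  then show "energy (prod.swap \<circ> basis_disc c) = energy (basis_disc c)"
    unfolding *
    by (intro energy_eq[OF basis_disc_swap_has_derivative[OF c]])
      (simp add: std_omega_basis_disc_deriv c)
qed

text \<open>The function \<open>S + x^2 / (2 S)\<close> increases in \<open>S > 0\<close> wherever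
  \<open>x^2 < 2 S^2\<close>, and \<open>S = sqrt (x^2 + c)\<close> satisfies even
  \<open>x^2 < S^2\<close>.\<close>

lemma basis_density_strict_mono:
  assumes "0 < c" "c < c'"
  shows "basis_density c x < basis_density c' x"
proof -
  define S S' where "S = sqrt (x\<^sup>2 + c)" and "S' = sqrt (x\<^sup>2 + c')"
  have S: "0 < S" "S < S'" using assms graph_pos(2)[of c x] by (simp_all add: S_def S'_def)
  have "x\<^sup>2 < S * S" using assms by (simp add: S_def)
  also have "\<dots> < S * S'" using S by simp
  finally have "x\<^sup>2 < 2 * (S * S')" using S by (smt (verit) mult_pos_pos)
  then have "0 < (S' - S) * (1 - x\<^sup>2 / (2 * S * S'))"
    using S by (intro mult_pos_pos) (auto simp: mult.assoc)
  also have "\<dots> = (S' + x\<^sup>2 / (2 * S')) - (S + x\<^sup>2 / (2 * S))"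
    using S by (simp add: field_simps)
  finally show ?thesis by (simp add: basis_density_def S_def S'_def)
qed

lemma energy_basis_disc_strict_mono:
  assumes "0 < c" "c < c'"
  shows "energy (basis_disc c) < energy (basis_disc c')"
proof -
  have cont: "continuous_on (cball 0 1) (\<lambda>w. basis_density d (Re w))" if "0 < d" for d
    using graph_pos(2)[OF that] unfolding basis_density_def
    by (auto intro!: continuous_intros simp: less_imp_neq[symmetric])
  have "integral (cball 0 1) (\<lambda>w. basis_density c (Re w))
      < integral (cball 0 1) (\<lambda>w. basis_density c' (Re w))"
    using assms by (intro integral_cball_strict_mono cont basis_density_strict_mono) auto
  then show ?thesis using assms by (simp add: energy_basis_disc divide_strict_right_mono)
qed

subsection \<open>Injectivity of \<open>j\<close> at the origin\<close>

lemma gross_psi_neg: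
  assumes psi: "is_gross_psi \<psi>" and t: "t < 0"
  shows "\<psi> (0, t) = energy (section_disc (exp t))"
proof -
  have "lagrangian_disc (0, t) (section_disc (exp t))" using lagrangian_section_disc[of "exp t"] t by simp
  moreover have "fst (section_disc (exp t) w) * snd (section_disc (exp t) w) = 1 + of_real (exp t) * w" for w
    by (simp add: section_disc_def flip: power2_eq_square)
  ultimately show ?thesis using psi t unfolding is_gross_psi_def by blast
qed

lemma gross_psi_pos:
  assumes psi: "is_gross_psi \<psi>" and t: "0 < t"
  shows "\<psi> (0, t) = energy (basis_disc ((exp t)\<^sup>2 - 1))"
proof -
  have c: "0 < (exp t)\<^sup>2 - 1" using t by simp
  have "\<psi> (0, t) = min (energy (basis_disc ((exp t)\<^sup>2 - 1)))
      (energy (prod.swap \<circ> basis_disc ((exp t)\<^sup>2 - 1)))"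
    using psi t lagrangian_basis_disc[of "exp t"] meets_divisor_basis_disc[OF c]
    unfolding is_gross_psi_def by (simp add: meets_divisor_swap)
  then show ?thesis by (simp only: energy_basis_disc(2)[OF c] min.idem)
qed

lemma gross_psi_axis_eqD:
  assumes psi: "is_gross_psi \<psi>" and eq: "\<psi> (0, t) = \<psi> (0, 0)"
  shows "t = 0"
proof (rule ccontr)
  assume "t \<noteq> 0"
  have "continuous_on UNIV \<psi>" using psi unfolding is_gross_psi_def by (rule conjunct1)
  then have "continuous_on UNIV (\<lambda>s. \<psi> (0, s))"
    by (rule continuous_on_compose2) (auto intro!: continuous_intros)
  then have lim: "((\<lambda>s. \<psi> (0, s)) \<longlongrightarrow> \<psi> (0, 0)) (at 0 within S)" for S
    by (meson UNIV_I continuous_on_def subset_UNIV tendsto_within_subset)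
  show False
  proof (cases "0 < t")
    case True
    have mono: "\<psi> (0, s) < \<psi> (0, s')" if "0 < s" "s < s'" for s s'
      using that by (simp add: gross_psi_pos[OF psi] energy_basis_disc_strict_mono power_strict_mono)
    \<comment> \<open>Limits preserve only weak inequalities; the midpoint \<open>t / 2\<close>
      leaves room for a strict one between it and \<open>t\<close>.\<close>
    have "eventually (\<lambda>s. \<psi> (0, s) \<le> \<psi> (0, t / 2)) (at_right 0)"
      using True mono by (auto simp: eventually_at_right[of 0 t] intro!: exI[of _ "t / 2"] less_imp_le)
    then have "\<psi> (0, 0) \<le> \<psi> (0, t / 2)" by (rule tendsto_upperbound[OF lim]) simp
    then show False using mono[of "t / 2" t] True eq by simp
  next
    case False
    then have t: "t < 0" using \<open>t \<noteq> 0\<close> by simp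
    have mono: "\<psi> (0, s) < \<psi> (0, s')" if "s < s'" "s' < 0" for s s'
      using that by (simp add: gross_psi_neg[OF psi] energy_section_disc_strict_mono)
    have "eventually (\<lambda>s. \<psi> (0, t / 2) \<le> \<psi> (0, s)) (at_left 0)"
      using t mono by (auto simp: eventually_at_left[of t 0] intro!: exI[of _ "t / 2"] less_imp_le)
    then have "\<psi> (0, t / 2) \<le> \<psi> (0, 0)" by (rule tendsto_lowerbound[OF lim]) simp
    then show False using mono[of t "t / 2"] t eq by simp
  qed
qed

lemma j_map_eq_originD:
  assumes psi: "is_gross_psi \<psi>" and eq: "j_map \<psi> q = j_map \<psi> (0, 0)"
  shows "q = (0, 0)"
proof (cases q)
  case (Pair q1 q2)
  have q1: "q1 = 0" using eq by (simp add: j_map_def Pair)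
  \<comment> \<open>The two minima give opposite inequalities between \<open>\<psi> (0, q2)\<close>
    and \<open>\<psi> (0, 0)\<close>.\<close>
  have "min (- \<psi> (0, q2)) (- \<psi> (0, 0)) = - \<psi> (0, 0)" "min (\<psi> (0, q2)) (\<psi> (0, 0)) = \<psi> (0, 0)"
    using eq by (simp_all add: j_map_def psi0_def Pair q1)
  then have "\<psi> (0, q2) = \<psi> (0, 0)" by linarith
  then show ?thesis using gross_psi_axis_eqD[OF psi] by (simp add: Pair q1)
qed

lemma inv_at_uniquely_attained: "(\<And>y. f y = f x \<Longrightarrow> y = x) \<Longrightarrow> inv f (f x) = x"
  unfolding inv_def by (rule some_equality) auto

lemma mem_dual_fibre_origin_iff:
  assumes psi: "is_gross_psi \<psi>"
  shows "p \<in> dual_fibre \<psi> (0, 0) \<longleftrightarrow> p \<in> mirror_domain \<and> F_map \<psi> p = (- psi0 \<psi> 0, psi0 \<psi> 0, 0)"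
proof -
  have j0: "j_map \<psi> (0, 0) = (- psi0 \<psi> 0, psi0 \<psi> 0, 0)" by (simp add: j_map_def psi0_def)
  have inv: "inv (j_map \<psi>) (j_map \<psi> (0, 0)) = (0, 0)"
    using j_map_eq_originD[OF psi] by (rule inv_at_uniquely_attained)
  show ?thesis
  proof
    assume "p \<in> dual_fibre \<psi> (0, 0)"
    then have p: "p \<in> mirror_domain" "F_map \<psi> p \<in> range (j_map \<psi>)" "inv (j_map \<psi>) (F_map \<psi> p) = (0, 0)"
      by (auto simp: dual_fibre_def dual_fibration_def split: if_splits)
    \<comment> \<open>The range test in \<open>dual_fibration\<close> lets \<open>j_map\<close> be
      applied to both sides; off the range the value of \<open>inv\<close> would carry no
      information.\<close>
    from f_inv_into_f[OF p(2)] p show "p \<in> mirror_domain \<and> F_map \<psi> p = (- psi0 \<psi> 0, psi0 \<psi> 0, 0)"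
      by (simp add: j0)
  next
    assume "p \<in> mirror_domain \<and> F_map \<psi> p = (- psi0 \<psi> 0, psi0 \<psi> 0, 0)"
    then show "p \<in> dual_fibre \<psi> (0, 0)"
      using inv by (simp add: dual_fibre_def dual_fibration_def flip: j0)
  qed
qed

subsection \<open>Valuations and the dual fibre\<close>

lemma le_val_iff: "ereal c \<le> val x \<longleftrightarrow> (\<forall>l. coeff x l \<noteq> 0 \<longrightarrow> c \<le> l)"
  by (auto simp: val_def le_INF_iff)

lemma val_zero [simp]: "val 0 = \<infinity>"
  by (simp add: val_def top_ereal_def)

text \<open>The infimum is attained because only finitely many exponents lie below any given
  one.\<close>

lemma val_leading:
  assumes "x \<noteq> 0"
  obtains k where "val x = ereal k" "coeff x k \<noteq> 0"
proof -
  obtain c where c: "coeff x c \<noteq> 0" using assms novikov_eqI[of x 0] by auto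
  let ?S = "{l. l \<le> c \<and> coeff x l \<noteq> 0}"
  have S: "finite ?S" "?S \<noteq> {}" using c by (auto simp: finite_supp)
  define k where "k = Min ?S"
  have k: "coeff x k \<noteq> 0" "k \<le> c" using Min_in[OF S] by (auto simp: k_def)
  have "k \<le> l" if "coeff x l \<noteq> 0" for l
    using that k Min_le[OF S(1), of l] by (cases "l \<le> c") (auto simp: k_def)
  then have "ereal k \<le> val x" by (simp add: le_val_iff)
  moreover have "val x \<le> ereal k" using k(1) by (auto simp: val_def intro: INF_lower)
  ultimately show ?thesis using that k(1) by (blast intro: antisym)
qed

text \<open>An infimum of nonnegative exponents is 0 exactly when 0 is itself an exponent. This
  reduces \<open>Lambda_plus\<close> and \<open>U_Lambda\<close> to conditions on constant
  terms.\<close>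

lemma val_eq_zero_iff: "val x = 0 \<longleftrightarrow> 0 \<le> val x \<and> coeff x 0 \<noteq> 0"
proof
  assume v: "val x = 0"
  then have "x \<noteq> 0" by auto
  then obtain k where "val x = ereal k" "coeff x k \<noteq> 0" by (rule val_leading)
  then show "0 \<le> val x \<and> coeff x 0 \<noteq> 0" using v by simp
next
  assume "0 \<le> val x \<and> coeff x 0 \<noteq> 0"
  moreover from this have "val x \<le> ereal 0" unfolding val_def by (intro INF_lower) auto
  ultimately show "val x = 0" by (simp add: zero_ereal_def antisym)
qed

lemma Lambda_plus_iff: "x \<in> Lambda_plus \<longleftrightarrow> x \<in> Lambda_0 \<and> coeff x 0 = 0"
  using val_eq_zero_iff[of x] by (auto simp: Lambda_plus_def Lambda_0_def less_le)

lemma U_Lambda_iff: "x \<in> U_Lambda \<longleftrightarrow> x \<in> Lambda_0 \<and> coeff x 0 \<noteq> 0"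
  using val_eq_zero_iff[of x] by (auto simp: U_Lambda_def Lambda_0_def)

lemma Lambda_0_iff: "x \<in> Lambda_0 \<longleftrightarrow> (\<forall>l. coeff x l \<noteq> 0 \<longrightarrow> 0 \<le> l)"
  using le_val_iff[of 0 x] by (simp add: Lambda_0_def zero_ereal_def)

text \<open>Multiplication by \<open>T_power c\<close> shifts the support by
  \<open>c\<close>.\<close>

lemma T_power_times_in_Lambda_0: "T_power c * x \<in> Lambda_0 \<longleftrightarrow> ereal (- c) \<le> val x"
proof -
  have "(\<forall>l. coeff x (l - c) \<noteq> 0 \<longrightarrow> 0 \<le> l) \<longleftrightarrow> (\<forall>l. coeff x l \<noteq> 0 \<longrightarrow> - c \<le> l)"
    by (metis add_diff_cancel_right' diff_add_cancel neg_le_iff_le le_diff_eq diff_0 minus_minus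
        diff_ge_0_iff_ge)
  then show ?thesis by (simp add: Lambda_0_iff le_val_iff coeff_monomial_times)
qed

lemma T_power_mult: "T_power a * T_power b = T_power (a + b)"
  by (rule novikov_eqI) (auto simp: coeff_monomial_times coeff_monomial)

lemma T_power_cancel [simp]:
  "T_power c * (T_power (- c) * x) = x" "T_power (- c) * (T_power c * x) = x"
  by (simp_all add: T_power_mult one_novikov_def[symmetric] flip: mult.assoc)

text \<open>Nonnegative exponents sum to 0 only as 0 + 0, so taking constant terms is
  multiplicative.\<close>

lemma Lambda_0_mult:
  assumes "x \<in> Lambda_0" "y \<in> Lambda_0"
  shows "x * y \<in> Lambda_0" "coeff (x * y) 0 = coeff x 0 * coeff y 0"
proof -
  show "x * y \<in> Lambda_0"
    unfolding Lambda_0_iff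
  proof (intro allI impI)
    fix l assume "coeff (x * y) l \<noteq> 0"
    then obtain a where "coeff x a \<noteq> 0" "coeff y (l - a) \<noteq> 0" using coeff_times_nonzeroD by blast
    then have "0 \<le> a" "0 \<le> l - a" using assms by (auto simp: Lambda_0_iff)
    then show "0 \<le> l" by simp
  qed
  have "coeff (x * y) 0 = (\<Sum>a\<in>{0}. coeff x a * coeff y (0 - a))"
  proof (rule coeff_times_sum)
    fix a assume "coeff x a \<noteq> 0" "coeff y (0 - a) \<noteq> 0"
    then have "0 \<le> a" "0 \<le> 0 - a" using assms unfolding Lambda_0_iff by blast+
    then show "a \<in> {0}" by simp
  qed simp
  then show "coeff (x * y) 0 = coeff x 0 * coeff y 0" by simp
qed

text \<open>The case \<open>x = 0\<close> must be excluded: \<open>real_of_ereal\<close> sends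
  infinity to 0, so \<open>rval 0 = 0\<close> although \<open>val 0\<close> is infinite.\<close>

lemma rval_eq_zero_iff: "x \<noteq> 0 \<Longrightarrow> rval x = 0 \<longleftrightarrow> val x = 0"
  by (erule val_leading) (simp add: rval_def zero_ereal_def)

text \<open>On the fibre the valuation of \<open>x1\<close> is at least
  \<open>psi0 \<psi> 0 > 0\<close>, which places the point in \<open>mirror_domain\<close>.\<close>

lemma nov_abs_less_1:
  assumes "ereal c \<le> val x" "0 < c"
  shows "nov_abs x < 1"
proof (cases "x = 0")
  case False
  then obtain k where "val x = ereal k" by (rule val_leading)
  then show ?thesis using assms by (simp add: nov_abs_def rval_def)
qed (simp add: nov_abs_def)

text \<open>A clipped coordinate of \<open>F_map\<close> that sits at its cap records only an
  inequality; \<open>x = 0\<close>, of infinite valuation, is included.\<close>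

lemma real_min_val_eq_iff: "real_of_ereal (min (val x) (ereal c)) = c \<longleftrightarrow> ereal c \<le> val x"
proof (cases "x = 0")
  case False
  then obtain k where "val x = ereal k" by (rule val_leading)
  then show ?thesis by (auto simp: min_def)
qed simp

lemma minus_one_val_zero_iff:
  assumes "a \<in> Lambda_0"
  shows "a - 1 \<noteq> 0 \<and> val (a - 1) = 0 \<longleftrightarrow> coeff a 0 \<noteq> 1"
proof -
  have "a - 1 \<in> Lambda_0" using assms by (auto simp: Lambda_0_iff coeff_one split: if_splits)
  then have "val (a - 1) = 0 \<longleftrightarrow> coeff a 0 \<noteq> 1"
    by (simp add: val_eq_zero_iff Lambda_0_def coeff_one)
  \<comment> \<open>A constant term other than 1 already forces \<open>a \<noteq> 1\<close>.\<close>
  then show ?thesis by force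
qed

section \<open>The fibre over the origin in the coordinates z0, z1\<close>

lemma z_coords_product:
  "(x0, x1, y) \<in> mirror_Y \<Longrightarrow>
    fst (z_coords \<psi> (x0, x1, y)) * snd (z_coords \<psi> (x0, x1, y)) = 1 + y"
proof -
  assume "(x0, x1, y) \<in> mirror_Y"
  moreover have "(T_power c * x0) * (T_power (- c) * x1) = (T_power c * (T_power (- c) * x0)) * x1" for c
    by (simp only: mult_ac)
  ultimately show ?thesis by (simp add: z_coords_def mirror_Y_def)
qed

text \<open>Both clipped coordinates sit at their caps, which puts \<open>z0\<close> and
  \<open>z1\<close> in \<open>Lambda_0\<close>; the third says that \<open>y = z0 * z1 - 1\<close>
  has valuation 0, a condition on constant terms.\<close>

lemma mem_dual_fibre_origin_iff_z_coords:
  assumes psi: "is_gross_psi \<psi>" and z: "z_coords \<psi> (x0, x1, y) = (z0, z1)"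
  shows "(x0, x1, y) \<in> dual_fibre \<psi> (0, 0) \<longleftrightarrow>
    x0 * x1 = 1 + y \<and> z0 \<in> Lambda_0 \<and> z1 \<in> Lambda_0 \<and> coeff z0 0 * coeff z1 0 \<noteq> 1"
proof -
  define c where "c = psi0 \<psi> 0"
  have c: "0 < c" using psi unfolding c_def psi0_def is_gross_psi_def by blast
  have L: "z0 \<in> Lambda_0 \<longleftrightarrow> ereal (- c) \<le> val x0" "z1 \<in> Lambda_0 \<longleftrightarrow> ereal c \<le> val x1"
    using z by (auto simp: z_coords_def c_def T_power_times_in_Lambda_0)
  have "(x0, x1, y) \<in> dual_fibre \<psi> (0, 0) \<longleftrightarrow>
      x0 * x1 = 1 + y \<and> z0 \<in> Lambda_0 \<and> z1 \<in> Lambda_0 \<and> y \<noteq> 0 \<and> val y = 0"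
  proof -
    have "F_map \<psi> (x0, x1, y) = (- c, c, 0) \<longleftrightarrow>
        rval y = 0 \<and> real_of_ereal (min (val x0) (ereal (- c))) = - c \<and>
        real_of_ereal (min (val x1) (ereal c)) = c"
      by (auto simp: F_map_def c_def)
    then show ?thesis
      unfolding mem_dual_fibre_origin_iff[OF psi] c_def[symmetric] real_min_val_eq_iff L
      using nov_abs_less_1[of c x1] c rval_eq_zero_iff[of y]
      by (auto simp: mirror_domain_def mirror_Y_def)
  qed
  also have "\<dots> \<longleftrightarrow>
      x0 * x1 = 1 + y \<and> z0 \<in> Lambda_0 \<and> z1 \<in> Lambda_0 \<and> coeff z0 0 * coeff z1 0 \<noteq> 1"
  proof -
    have "y = z0 * z1 - 1" if "x0 * x1 = 1 + y"
    proof (cases "y = 0")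
      case False
      then show ?thesis using z_coords_product[of x0 x1 y \<psi>] that z by (simp add: mirror_Y_def)
    next
      case True
      \<comment> \<open>With \<open>y = 0\<close> the point lies outside \<open>mirror_Y\<close>, so
        \<open>z_coords_product\<close> does not apply and the powers of T are cancelled
        directly.\<close>
      have "z0 * z1 = (T_power c * (T_power (- c) * x0)) * x1"
        using z by (auto simp: z_coords_def c_def mult_ac)
      then show ?thesis using that True by simp
    qed
    then show ?thesis
      using Lambda_0_mult[of z0 z1] minus_one_val_zero_iff[of "z0 * z1"] by auto
  qed
  finally show ?thesis .
qed

lemma bij_betw_z_coords_dual_fibre:
  assumes psi: "is_gross_psi \<psi>"
  shows "bij_betw (z_coords \<psi>) (dual_fibre \<psi> (0, 0))
    {(z0, z1). z0 \<in> Lambda_0 \<and> z1 \<in> Lambda_0 \<and> coeff z0 0 * coeff z1 0 \<noteq> 1}"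
proof (rule bij_betw_byWitness)
  define c where "c = psi0 \<psi> 0"
  \<comment> \<open>The inverse undoes the rescaling and recovers \<open>y\<close> from the defining
    equation of \<open>mirror_Y\<close>.\<close>
  let ?g = "\<lambda>(z0, z1). (T_power (- c) * z0, T_power c * z1, z0 * z1 - 1)"
  have g: "z_coords \<psi> (?g (z0, z1)) = (z0, z1)" for z0 z1
    by (simp add: z_coords_def c_def)
  have prod: "(T_power (- c) * z0) * (T_power c * z1) = z0 * z1" for z0 z1
  proof -
    have "(T_power (- c) * z0) * (T_power c * z1) = (T_power (- c) * (T_power c * z0)) * z1"
      by (simp only: mult_ac)
    then show ?thesis by simp
  qed
  show "\<forall>p\<in>dual_fibre \<psi> (0, 0). ?g (z_coords \<psi> p) = p"
  proof clarify
    fix x0 x1 y assume p: "(x0, x1, y) \<in> dual_fibre \<psi> (0, 0)"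
    then have "(x0, x1, y) \<in> mirror_Y"
      using mem_dual_fibre_origin_iff[OF psi] by (auto simp: mirror_domain_def)
    from z_coords_product[OF this, of \<psi>]
    show "?g (z_coords \<psi> (x0, x1, y)) = (x0, x1, y)"
      by (simp add: z_coords_def c_def)
  qed
  show "\<forall>z\<in>{(z0, z1). z0 \<in> Lambda_0 \<and> z1 \<in> Lambda_0 \<and> coeff z0 0 * coeff z1 0 \<noteq> 1}.
      z_coords \<psi> (?g z) = z"
    using g by auto
  show "z_coords \<psi> ` dual_fibre \<psi> (0, 0) \<subseteq>
      {(z0, z1). z0 \<in> Lambda_0 \<and> z1 \<in> Lambda_0 \<and> coeff z0 0 * coeff z1 0 \<noteq> 1}"
  proof clarify
    fix x0 x1 y z0 z1
    assume "(x0, x1, y) \<in> dual_fibre \<psi> (0, 0)" "(z0, z1) = z_coords \<psi> (x0, x1, y)"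
    then show "z0 \<in> Lambda_0 \<and> z1 \<in> Lambda_0 \<and> coeff z0 0 * coeff z1 0 \<noteq> 1"
      using mem_dual_fibre_origin_iff_z_coords[OF psi, of x0 x1 y z0 z1] by simp
  qed
  show "?g ` {(z0, z1). z0 \<in> Lambda_0 \<and> z1 \<in> Lambda_0 \<and> coeff z0 0 * coeff z1 0 \<noteq> 1} \<subseteq>
      dual_fibre \<psi> (0, 0)"
    using mem_dual_fibre_origin_iff_z_coords[OF psi g[unfolded prod.case]] by (auto simp: prod)
qed

lemma bij_betw_Un_obtain:
  assumes f: "bij_betw f F (A \<union> B)" and disj: "A \<inter> B = {}"
  obtains S T where "F = S \<union> T" "S \<inter> T = {}" "bij_betw f S A" "bij_betw f T B"
proof
  have image: "f ` F = A \<union> B" and inj: "inj_on f F" using f by (simp_all add: bij_betw_def)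
  show "F = (F \<inter> f -` A) \<union> (F \<inter> f -` B)" using image by blast
  show "(F \<inter> f -` A) \<inter> (F \<inter> f -` B) = {}" using disj by blast
  have "f ` (F \<inter> f -` C) = C" if "C \<subseteq> A \<union> B" for C
    using that unfolding image[symmetric] by blast
  then show "bij_betw f (F \<inter> f -` A) A" "bij_betw f (F \<inter> f -` B) B"
    by (simp_all add: bij_betw_def inj_on_subset[OF inj])
qed

text \<open>The Hong-Kim-Lau result enters as the bijection \<open>hkl\<close>, and the equality of
  the Maurer-Cartan set with \<open>S1\<close> is read as equality of their images under
  \<open>hkl\<close> and \<open>z_coords\<close>.\<close>

theorem mainTheorem5:
  fixes \<psi> :: "real \<times> real \<Rightarrow> real"
    and MC :: "(complex \<times> complex) set \<Rightarrow> 'b set"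
    and hkl :: "'b \<Rightarrow> novikov \<times> novikov"
  assumes psi: "is_gross_psi \<psi>"
    and Hong_Kim_Lau: "bij_betw hkl (MC (gross_fibre (0, 0)))
          ((Lambda_0 \<times> Lambda_plus) \<union> (Lambda_plus \<times> Lambda_0))"
  shows "(\<forall>x0 x1 y. (x0, x1, y) \<in> mirror_Y \<longrightarrow>
            fst (z_coords \<psi> (x0, x1, y)) * snd (z_coords \<psi> (x0, x1, y)) = 1 + y) \<and>
    (\<exists>S1 S2.
       dual_fibre \<psi> (0, 0) = S1 \<union> S2 \<and> S1 \<inter> S2 = {} \<and>
       bij_betw (z_coords \<psi>) S1 ((Lambda_0 \<times> Lambda_plus) \<union> (Lambda_plus \<times> Lambda_0)) \<and>
       bij_betw (z_coords \<psi>) S2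
         {(z0, z1). z0 \<in> U_Lambda \<and> z1 \<in> U_Lambda \<and> reduction z0 * reduction z1 \<noteq> 1} \<and>
       hkl ` MC (gross_fibre (0, 0)) = z_coords \<psi> ` S1 \<and>
       S1 \<subset> dual_fibre \<psi> (0, 0))"
proof -
  let ?F = "dual_fibre \<psi> (0, 0)" and ?z = "z_coords \<psi>"
  let ?P = "{(z0, z1). z0 \<in> Lambda_0 \<and> z1 \<in> Lambda_0 \<and> coeff z0 0 * coeff z1 0 \<noteq> 1}"
  let ?A = "(Lambda_0 \<times> Lambda_plus) \<union> (Lambda_plus \<times> Lambda_0)"
  let ?B = "{(z0, z1). z0 \<in> U_Lambda \<and> z1 \<in> U_Lambda \<and> reduction z0 * reduction z1 \<noteq> 1}"
  \<comment> \<open>If a constant term vanishes, the product is 0 and so automatically differs from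
    1; if neither does, both entries lie in \<open>U_Lambda\<close>.\<close>
  have P: "?P = ?A \<union> ?B" and disj: "?A \<inter> ?B = {}"
    by (auto simp: Lambda_plus_iff U_Lambda_iff reduction_def)
  obtain S1 S2 where S: "?F = S1 \<union> S2" "S1 \<inter> S2 = {}"
      and S1: "bij_betw ?z S1 ?A" and S2: "bij_betw ?z S2 ?B"
    by (rule bij_betw_Un_obtain[OF bij_betw_z_coords_dual_fibre[OF psi, unfolded P] disj])
  \<comment> \<open>The constants 1 and 2 have product 2, different from 1; so \<open>S2\<close> is
    nonempty and the inclusion is strict.\<close>
  have "(1, monomial 2 0) \<in> ?B"
    by (auto simp: U_Lambda_iff Lambda_0_iff reduction_def coeff_one coeff_monomial split: if_splits)
  then have "(1, monomial 2 0) \<in> ?z ` S2" by (simp only: bij_betw_imp_surj_on[OF S2])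
  then have "S2 \<noteq> {}" by blast
  then have "S1 \<subset> ?F" unfolding S(1) using S(2) by blast
  moreover have "hkl ` MC (gross_fibre (0, 0)) = ?z ` S1"
    by (simp only: bij_betw_imp_surj_on[OF Hong_Kim_Lau] bij_betw_imp_surj_on[OF S1])
  ultimately show ?thesis
    using S S1 S2 by (intro conjI exI[of _ S1] exI[of _ S2] allI impI z_coords_product)
qed

end
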